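(* Let $N\ge1$, let $S$ be a finite set of endomorphisms of $\mathbb{P}^N$ defined over $\overline{\mathbb{Q}}$, all of degree at least two, and let $\nu$ be a discrete probability measure on $S$ with $\nu(\phi)>0$ for all $\phi\in S$. Let $\delta_{S,\nu}$ be the dynamical degree of $(S,\nu)$ and let $B_S=C_S/(d_S-1)$. Then for $\bar\nu$-almost every $\gamma\in\Phi_S$ the limits $$\lim_{B\to\infty}\frac{\#\{Q\in\mathrm{Orb}_\gamma^-(P):h(Q)\le B\}}{\log(B)}=\frac{1}{\log\delta_{S,\nu}}=\lim_{B\to\infty}\frac{\#\{W\in\mathrm{Orb}_\gamma^+(P):h(W)\le B\}}{\log(B)}$$ hold (simultaneously) for all $P\in\mathbb{P}^N(\overline{\mathbb{Q}})$ with $h(P)>3B_S$.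
   Context: $h:\mathbb{P}^N(\overline{\mathbb{Q}})\to\mathbb{R}_{\ge0}$ is the absolute logarithmic Weil height. For an endomorphism $\phi$ of $\mathbb{P}^N$ of degree $d_\phi$ (degree of its defining homogeneous polynomials), $C(\phi)=\sup_{P\in\mathbb{P}^N(\overline{\mathbb{Q}})}|h(\phi(P))-d_\phi h(P)|<\infty$. Put $d_S=\inf\{d_\phi:\phi\in S\}$ and $C_S=\sup\{C(\phi):\phi\in S\}$. $\Phi_S=\prod_{i=1}^\infty S$ is the set of infinite sequences in $S$, with product measure $\bar\nu=\prod_{i=1}^\infty\nu$. For $\gamma=(\theta_1,\theta_2,\dots)\in\Phi_S$ and $n\ge1$: $\gamma_n^-=\theta_n\circ\cdots\circ\theta_1$, $\gamma_n^+=\theta_1\circ\cdots\circ\theta_n$, and $\gamma_0^\pm=\mathrm{Id}$. The left and right orbits are the sets $\mathrm{Orb}_\gamma^\pm(P)=\{\gamma_n^\pm(P):n\ge0\}$. The dynamical degree $\delta_{S,\nu}$ is the constant such that $\lim_{n\to\infty}\deg(\gamma_n^\pm)^{1/n}=\delta_{S,\nu}$ (for both signs) for $\bar\nu$-almost every $\gamma$; it exists, and here $\delta_{S,\nu}=\prod_{\phi\in S}\deg(\phi)^{\nu(\phi)}$. *)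

theory Defs
  imports
    "HOL-Probability.Probability"
    "HOL-Algebra.Algebraic_Closure_Type"
    "HOL-Computational_Algebra.Primes"
    "HOL-Library.Poly_Mapping"
begin

unbundle no fps_syntax

section \<open>Projective space\<close>

type_synonym qbar = "rat alg_closure"

definition proj_rel :: "'a::field ^ 'n \<Rightarrow> 'a ^ 'n \<Rightarrow> bool" where
  "proj_rel x y \<longleftrightarrow> x \<noteq> 0 \<and> y \<noteq> 0 \<and> (\<exists>c. c \<noteq> 0 \<and> y = c *s x)"

text \<open>
  Projective space of dimension \<open>CARD('n) - 1\<close> over \<open>'a\<close>: the nonzero vectors up to nonzero
  scalars.  The point with homogeneous coordinates \<open>x\<close> is \<open>proj_point x\<close>; this is
  meaningful only for \<open>x \<noteq> 0\<close>.
\<close>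

quotient_type (overloaded) ('a, 'n) proj = "'a::field ^ 'n::finite" / partial: proj_rel
  morphisms rep_proj proj_point
proof (rule part_equivpI)
  have "proj_rel 1 (1 :: 'a ^ 'n)"
    by (auto simp: proj_rel_def vec_eq_iff intro!: exI[of _ 1])
  then show "\<exists>x :: 'a ^ 'n. proj_rel x x" ..
  show "symp (proj_rel :: 'a ^ 'n \<Rightarrow> _)"
  proof (rule sympI)
    fix x y :: "'a ^ 'n"
    assume "proj_rel x y"
    then obtain c where c: "x \<noteq> 0" "y \<noteq> 0" "c \<noteq> 0" "y = c *s x"
      by (auto simp: proj_rel_def)
    then have "x = inverse c *s y" by (simp add: vector_smult_assoc)
    moreover have "inverse c \<noteq> 0" using c by simp
    ultimately show "proj_rel y x" using c unfolding proj_rel_def by blast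
  qed
  show "transp (proj_rel :: 'a ^ 'n \<Rightarrow> _)"
  proof (rule transpI)
    fix x y z :: "'a ^ 'n"
    assume "proj_rel x y" "proj_rel y z"
    then obtain c d where cd: "x \<noteq> 0" "z \<noteq> 0" "c \<noteq> 0" "d \<noteq> 0" "y = c *s x" "z = d *s y"
      by (auto simp: proj_rel_def)
    then have "z = (d * c) *s x" "d * c \<noteq> 0" by (simp_all add: vector_smult_assoc)
    then show "proj_rel x z" using cd unfolding proj_rel_def by blast
  qed
qed

section \<open>Endomorphisms of projective space\<close>

text \<open>Polynomials in variables indexed by \<open>'n\<close>: finitely supported maps from exponent vectors
  to coefficients.\<close>

type_synonym ('a, 'n) mvpoly = "('n \<Rightarrow>\<^sub>0 nat) \<Rightarrow>\<^sub>0 'a"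

definition mvpoly_eval :: "'a::field ^ 'n \<Rightarrow> ('a, 'n::finite) mvpoly \<Rightarrow> 'a" where
  "mvpoly_eval x F =
    (\<Sum>m\<in>Poly_Mapping.keys F. Poly_Mapping.lookup F m * (\<Prod>i\<in>UNIV. (x $ i) ^ Poly_Mapping.lookup m i))"

definition homogeneous :: "nat \<Rightarrow> ('a::field, 'n::finite) mvpoly \<Rightarrow> bool" where
  "homogeneous d F \<longleftrightarrow> (\<forall>m\<in>Poly_Mapping.keys F. (\<Sum>i\<in>UNIV. Poly_Mapping.lookup m i) = d)"

text \<open>
  \<open>defines_map d F \<phi>\<close>: the forms \<open>F\<^sub>i\<close>, all of degree \<open>d\<close>, have no common zero
  in projective space, and \<open>\<phi>\<close> is the map \<open>[x] \<mapsto> [F\<^sub>i(x)]\<^sub>i\<close>.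
\<close>

definition defines_map ::
    "nat \<Rightarrow> ('n \<Rightarrow> ('a::field, 'n::finite) mvpoly) \<Rightarrow> (('a, 'n) proj \<Rightarrow> ('a, 'n) proj) \<Rightarrow> bool" where
  "defines_map d F \<phi> \<longleftrightarrow>
    (\<forall>i. homogeneous d (F i)) \<and>
    (\<forall>x. x \<noteq> 0 \<longrightarrow> (\<exists>i. mvpoly_eval x (F i) \<noteq> 0)) \<and>
    (\<forall>x. x \<noteq> 0 \<longrightarrow> \<phi> (proj_point x) = proj_point (\<chi> i. mvpoly_eval x (F i)))"

text \<open>
  Over an algebraically closed field an endomorphism is determined by its effect on points, so
  endomorphisms are taken to be maps on points, and the degree of the defining forms depends
  only on the map (in dimension at least one).
\<close>

definition endomorphism :: "(('a::alg_closed_field, 'n::finite) proj \<Rightarrow> ('a, 'n) proj) \<Rightarrow> bool" where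
  "endomorphism \<phi> \<longleftrightarrow> (\<exists>d F. defines_map d F \<phi>)"

definition endo_degree :: "(('a::alg_closed_field, 'n::finite) proj \<Rightarrow> ('a, 'n) proj) \<Rightarrow> nat" where
  "endo_degree \<phi> = (THE d. \<exists>F. defines_map d F \<phi>)"

section \<open>The absolute logarithmic Weil height\<close>

global_interpretation qbar: vector_space "\<lambda>(q::rat) (x::qbar). of_rat q * x"
  defines qbar_span = qbar.span and qbar_dim = qbar.dim
  by unfold_locales (simp_all add: algebra_simps of_rat_add of_rat_mult)

definition number_field :: "qbar set \<Rightarrow> bool" where
  "number_field K \<longleftrightarrow>
    1 \<in> K \<and> (\<forall>x\<in>K. \<forall>y\<in>K. x - y \<in> K \<and> x * y \<in> K) \<and> (\<forall>x\<in>K. inverse x \<in> K) \<and>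
    (\<exists>B. finite B \<and> K \<subseteq> qbar_span B)"

definition padic_abs :: "nat \<Rightarrow> rat \<Rightarrow> real" where
  "padic_abs p q = (if q = 0 then 0 else
     real p powi (int (multiplicity (int p) (snd (quotient_of q)))
                - int (multiplicity (int p) (fst (quotient_of q)))))"

text \<open>
  The places of \<open>K\<close>: the absolute values on \<open>K\<close> that restrict to the usual or to a \<open>p\<close>-adic
  absolute value on the rationals.  They are functions on all of \<open>qbar\<close>, fixed to be
  \<open>undefined\<close> outside \<open>K\<close>, so that each place occurs exactly once.
\<close>

definition places :: "qbar set \<Rightarrow> (qbar \<Rightarrow> real) set" where
  "places K = {v \<in> extensional K.
     (\<forall>x\<in>K. 0 \<le> v x \<and> (v x = 0 \<longleftrightarrow> x = 0)) \<and>
     (\<forall>x\<in>K. \<forall>y\<in>K. v (x * y) = v x * v y \<and> v (x + y) \<le> v x + v y) \<and>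
     ((\<forall>q. v (of_rat q) = \<bar>of_rat q\<bar>) \<or> (\<exists>p. Factorial_Ring.prime p \<and> (\<forall>q. v (of_rat q) = padic_abs p q)))}"

definition v_null :: "(qbar \<Rightarrow> real) \<Rightarrow> (nat \<Rightarrow> qbar) \<Rightarrow> bool" where
  "v_null v x \<longleftrightarrow> (\<lambda>n. v (x n)) \<longlonglongrightarrow> 0"

definition v_Cauchy :: "(qbar \<Rightarrow> real) \<Rightarrow> (nat \<Rightarrow> qbar) \<Rightarrow> bool" where
  "v_Cauchy v x \<longleftrightarrow> (\<forall>e>0. \<exists>M. \<forall>m\<ge>M. \<forall>n\<ge>M. v (x m - x n) < e)"

text \<open>
  The local degree \<open>[K\<^sub>v : \<rat>\<^sub>v]\<close>.  Elements of the completion \<open>K\<^sub>v\<close> are Cauchy sequences in \<open>K\<close>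
  modulo null sequences, and \<open>\<rat>\<^sub>v\<close> is the subfield of classes of Cauchy sequences of rationals;
  the dimension of \<open>K\<^sub>v\<close> over \<open>\<rat>\<^sub>v\<close> is the largest size \<open>m\<close> of a linearly independent family
  \<open>x 0, \<dots>, x (m - 1)\<close>, everything being written out on representing sequences.
\<close>

definition local_degree :: "qbar set \<Rightarrow> (qbar \<Rightarrow> real) \<Rightarrow> nat" where
  "local_degree K v = Sup {m. \<exists>x :: nat \<Rightarrow> nat \<Rightarrow> qbar.
     (\<forall>i<m. range (x i) \<subseteq> K \<and> v_Cauchy v (x i)) \<and>
     (\<forall>c :: nat \<Rightarrow> nat \<Rightarrow> rat.
        (\<forall>i<m. v_Cauchy v (\<lambda>n. of_rat (c i n))) \<and> v_null v (\<lambda>n. \<Sum>i<m. of_rat (c i n) * x i n)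
        \<longrightarrow> (\<forall>i<m. v_null v (\<lambda>n. of_rat (c i n))))}"

definition height_over :: "qbar set \<Rightarrow> qbar ^ 'n::finite \<Rightarrow> real" where
  "height_over K x =
    (\<Sum>\<^sub>\<infinity>v\<in>places K. real (local_degree K v) * ln (MAX i. v (x $ i))) / real (qbar_dim K)"

text \<open>The height does not depend on the number field or on the homogeneous coordinates in it.\<close>

definition weil_height :: "(qbar, 'n::finite) proj \<Rightarrow> real" where
  "weil_height P = (THE r. \<exists>K x. number_field K \<and> x \<noteq> 0 \<and> (\<forall>i. x $ i \<in> K) \<and>
                 P = proj_point x \<and> r = height_over K x)"

section \<open>Constants attached to a set of endomorphisms\<close>

text \<open>
  The suprema are taken in the extended reals, so that they are meaningful without first showing
  that they are finite.
\<close>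

definition C_map :: "((qbar, 'n::finite) proj \<Rightarrow> (qbar, 'n) proj) \<Rightarrow> ereal" where
  "C_map \<phi> = (SUP P. ereal \<bar>weil_height (\<phi> P) - real (endo_degree \<phi>) * weil_height P\<bar>)"

definition C_set :: "((qbar, 'n::finite) proj \<Rightarrow> (qbar, 'n) proj) set \<Rightarrow> ereal" where
  "C_set S = (SUP \<phi>\<in>S. C_map \<phi>)"

definition d_set :: "((qbar, 'n::finite) proj \<Rightarrow> (qbar, 'n) proj) set \<Rightarrow> nat" where
  "d_set S = (INF \<phi>\<in>S. endo_degree \<phi>)"

definition B_set :: "((qbar, 'n::finite) proj \<Rightarrow> (qbar, 'n) proj) set \<Rightarrow> ereal" where
  "B_set S = C_set S / ereal (real (d_set S) - 1)"

section \<open>Random orbits and the dynamical degree\<close>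

text \<open>The sequence \<open>(\<theta>\<^sub>1, \<theta>\<^sub>2, \<dots>)\<close> is represented by \<open>\<gamma>\<close> with \<open>\<gamma> n = \<theta>\<^bsub>n+1\<^esub>\<close>.\<close>

primrec left_iter :: "(nat \<Rightarrow> 'a \<Rightarrow> 'a) \<Rightarrow> nat \<Rightarrow> 'a \<Rightarrow> 'a" where
  "left_iter \<gamma> 0 = id"
| "left_iter \<gamma> (Suc n) = \<gamma> n \<circ> left_iter \<gamma> n"

primrec right_iter :: "(nat \<Rightarrow> 'a \<Rightarrow> 'a) \<Rightarrow> nat \<Rightarrow> 'a \<Rightarrow> 'a" where
  "right_iter \<gamma> 0 = id"
| "right_iter \<gamma> (Suc n) = right_iter \<gamma> n \<circ> \<gamma> n"

definition left_orbit :: "(nat \<Rightarrow> 'a \<Rightarrow> 'a) \<Rightarrow> 'a \<Rightarrow> 'a set" where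
  "left_orbit \<gamma> P = {left_iter \<gamma> n P | n. True}"

definition right_orbit :: "(nat \<Rightarrow> 'a \<Rightarrow> 'a) \<Rightarrow> 'a \<Rightarrow> 'a set" where
  "right_orbit \<gamma> P = {right_iter \<gamma> n P | n. True}"

definition seq_measure :: "'a measure \<Rightarrow> (nat \<Rightarrow> 'a) measure" where
  "seq_measure \<nu> = (\<Pi>\<^sub>M i\<in>UNIV. \<nu>)"

definition dynamical_degree ::
    "((qbar, 'n::finite) proj \<Rightarrow> (qbar, 'n) proj) measure \<Rightarrow> real" where
  "dynamical_degree \<nu> = (THE \<delta>. AE \<gamma> in seq_measure \<nu>.
     (\<lambda>n. root n (real (endo_degree (left_iter \<gamma> n)))) \<longlonglongrightarrow> \<delta> \<and>
     (\<lambda>n. root n (real (endo_degree (right_iter \<gamma> n)))) \<longlonglongrightarrow> \<delta>)"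

end

theory Submission
  imports Defs "HOL-Real_Asymp.Real_Asymp"
begin

text \<open>
  If \<open>C\<^sub>S = \<infinity>\<close> no point satisfies the hypothesis.  Otherwise the bound
  \<open>\<bar>h(f P) - d h(P)\<bar> \<le> B\<^sub>S (d - 1)\<close> with \<open>d = deg f\<close> holds for all \<open>f \<in> S\<close> and is stable
  under composition, hence it holds for both kinds of iterates.  Since degrees at least double,
  \<open>h(P) > 3 B\<^sub>S\<close> makes the heights along the orbit strictly increasing, and
  \<open>log h(\<gamma>\<^sub>n P) = log deg \<gamma>\<^sub>n + O(1)\<close>.  Degrees are multiplicative, so the strong law of large numbers
  gives \<open>log deg \<gamma>\<^sub>n \<sim> n log \<delta>\<close> almost surely, for a null set independent of \<open>P\<close>, and inverting
  this growth counts the orbit points of height at most \<open>B\<close>.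
\<close>

no_notation fps_nth (infixl "$" 75)

hide_const (open) Polynomials.lead_coeff Polynomials.degree up_ring.coeff module.smult Coset.order

section \<open>Forms\<close>

text \<open>Forms are treated as functions: products and composites are expanded into monomials
  pointwise, with no substitution of polynomials into polynomials.\<close>

definition is_form :: "nat \<Rightarrow> ('a::field ^ 'n::finite \<Rightarrow> 'a) \<Rightarrow> bool" where
  "is_form d f \<longleftrightarrow> (\<exists>F. homogeneous d F \<and> (\<forall>x. mvpoly_eval x F = f x))"

text \<open>Cancellation may shrink the support of a sum; a common larger index set lets
  \<open>F\<close>, \<open>G\<close> and \<open>F + G\<close> be compared term by term.\<close>

lemma mvpoly_eval_superset:
  assumes "finite A" "Poly_Mapping.keys F \<subseteq> A"
  shows "mvpoly_eval x F =
    (\<Sum>m\<in>A. Poly_Mapping.lookup F m * (\<Prod>i\<in>UNIV. (x $ i) ^ Poly_Mapping.lookup m i))"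
  unfolding mvpoly_eval_def using assms
  by (intro sum.mono_neutral_left) (auto simp: in_keys_iff)

lemma is_form_zero: "is_form d (\<lambda>x. 0)"
  unfolding is_form_def by (intro exI[of _ 0]) (auto simp: homogeneous_def mvpoly_eval_def)

lemma is_form_add:
  assumes "is_form d f" "is_form d g"
  shows "is_form d (\<lambda>x. f x + g x)"
proof -
  obtain F G where F: "homogeneous d F" "\<And>x. mvpoly_eval x F = f x"
    and G: "homogeneous d G" "\<And>x. mvpoly_eval x G = g x"
    using assms unfolding is_form_def by metis
  let ?A = "Poly_Mapping.keys F \<union> Poly_Mapping.keys G"
  have keys: "Poly_Mapping.keys (F + G) \<subseteq> ?A" by (rule Poly_Mapping.keys_add)
  have "mvpoly_eval x (F + G) = f x + g x" for x
    using mvpoly_eval_superset[OF _ keys, of x] mvpoly_eval_superset[of ?A F x]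
      mvpoly_eval_superset[of ?A G x] F(2) G(2)
    by (simp add: lookup_add sum.distrib algebra_simps)
  moreover have "homogeneous d (F + G)"
    using F(1) G(1) keys unfolding homogeneous_def by blast
  ultimately show ?thesis unfolding is_form_def by blast
qed

lemma is_form_sum:
  assumes "\<And>i. i \<in> A \<Longrightarrow> is_form d (f i)"
  shows "is_form d (\<lambda>x. \<Sum>i\<in>A. f i x)"
  using assms
  by (induction A rule: infinite_finite_induct) (auto intro: is_form_zero is_form_add)

lemma is_form_monomial:
  "is_form (\<Sum>i\<in>UNIV. Poly_Mapping.lookup m i)
    (\<lambda>x. c * (\<Prod>i\<in>UNIV. (x $ i) ^ Poly_Mapping.lookup m i))"
  unfolding is_form_def
  by (intro exI[of _ "Poly_Mapping.single m c"])
     (auto simp: homogeneous_def mvpoly_eval_def split: if_splits)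

lemma is_form_iff:
  fixes f :: "'a::field ^ 'n::finite \<Rightarrow> 'a"
  shows "is_form d f \<longleftrightarrow>
    (\<exists>F. (\<forall>m\<in>Poly_Mapping.keys F. (\<Sum>i\<in>UNIV. Poly_Mapping.lookup m i) = d) \<and>
      f = (\<lambda>x. \<Sum>m\<in>Poly_Mapping.keys F.
        Poly_Mapping.lookup F m * (\<Prod>i\<in>UNIV. (x $ i) ^ Poly_Mapping.lookup m i)))"
  unfolding is_form_def homogeneous_def mvpoly_eval_def fun_eq_iff by (simp add: eq_commute)

lemma is_form_mult:
  assumes "is_form d f" "is_form e g"
  shows "is_form (d + e) (\<lambda>x. f x * g x)"
proof -
  obtain F where F: "\<forall>m\<in>Poly_Mapping.keys F. (\<Sum>i\<in>UNIV. Poly_Mapping.lookup m i) = d"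
    "f = (\<lambda>x. \<Sum>m\<in>Poly_Mapping.keys F.
        Poly_Mapping.lookup F m * (\<Prod>i\<in>UNIV. (x $ i) ^ Poly_Mapping.lookup m i))"
    using assms(1) unfolding is_form_iff by blast
  obtain G where G: "\<forall>m\<in>Poly_Mapping.keys G. (\<Sum>i\<in>UNIV. Poly_Mapping.lookup m i) = e"
    "g = (\<lambda>x. \<Sum>m\<in>Poly_Mapping.keys G.
        Poly_Mapping.lookup G m * (\<Prod>i\<in>UNIV. (x $ i) ^ Poly_Mapping.lookup m i))"
    using assms(2) unfolding is_form_iff by blast
  have "(\<lambda>x. f x * g x) = (\<lambda>x. \<Sum>m\<in>Poly_Mapping.keys F. \<Sum>n\<in>Poly_Mapping.keys G.
      (Poly_Mapping.lookup F m * Poly_Mapping.lookup G n) *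
      (\<Prod>i\<in>UNIV. (x $ i) ^ Poly_Mapping.lookup (m + n) i))"
    unfolding F(2) G(2)
    by (simp add: sum_product lookup_add power_add prod.distrib mult_ac)
  moreover have "is_form (d + e) \<dots>"
  proof (intro is_form_sum)
    fix m n assume mn: "m \<in> Poly_Mapping.keys F" "n \<in> Poly_Mapping.keys G"
    have "(\<Sum>i\<in>UNIV. Poly_Mapping.lookup (m + n) i) = d + e"
      using bspec[OF F(1) mn(1)] bspec[OF G(1) mn(2)] by (simp add: lookup_add sum.distrib)
    then show "is_form (d + e) (\<lambda>x. (Poly_Mapping.lookup F m * Poly_Mapping.lookup G n) *
      (\<Prod>i\<in>UNIV. (x $ i) ^ Poly_Mapping.lookup (m + n) i))"
      using is_form_monomial[of "m + n"] by simp
  qed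
  ultimately show ?thesis by simp
qed

lemma is_form_const: "is_form 0 (\<lambda>x. c)"
  using is_form_monomial[of 0 c] by simp

lemma is_form_prod:
  assumes "finite A" "\<And>i. i \<in> A \<Longrightarrow> is_form (d i) (f i)"
  shows "is_form (\<Sum>i\<in>A. d i) (\<lambda>x. \<Prod>i\<in>A. f i x)"
  using assms by (induction A rule: finite_induct) (auto intro: is_form_const is_form_mult)

lemma is_form_power: "is_form d f \<Longrightarrow> is_form (k * d) (\<lambda>x. f x ^ k)"
  by (induction k) (auto intro: is_form_const is_form_mult)

lemma is_form_coordinate: "is_form 1 (\<lambda>x. x $ i)"
  using is_form_monomial[of "Poly_Mapping.single i 1" 1]
  by (simp add: lookup_single when_def if_distrib[of "power _"] cong: if_cong)

text \<open>A monomial with exponents \<open>m\<close> becomes a product of powers of the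
  \<open>g i\<close>; the exponents add up to \<open>d\<close>, so its degree is
  \<open>d * e\<close>.\<close>

lemma is_form_comp:
  assumes f: "is_form d f" and g: "\<And>i. is_form e (g i)"
  shows "is_form (d * e) (\<lambda>x. f (\<chi> i. g i x))"
proof -
  obtain F where F: "\<forall>m\<in>Poly_Mapping.keys F. (\<Sum>i\<in>UNIV. Poly_Mapping.lookup m i) = d"
    "f = (\<lambda>x. \<Sum>m\<in>Poly_Mapping.keys F.
        Poly_Mapping.lookup F m * (\<Prod>i\<in>UNIV. (x $ i) ^ Poly_Mapping.lookup m i))"
    using f unfolding is_form_iff by blast
  show ?thesis unfolding F(2)
  proof (rule is_form_sum)
    fix m assume m: "m \<in> Poly_Mapping.keys F"
    have "is_form (\<Sum>i\<in>UNIV. Poly_Mapping.lookup m i * e)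
        (\<lambda>x. \<Prod>i\<in>UNIV. g i x ^ Poly_Mapping.lookup m i)"
      by (intro is_form_prod is_form_power g) auto
    then have "is_form (d * e) (\<lambda>x. \<Prod>i\<in>UNIV. g i x ^ Poly_Mapping.lookup m i)"
      using bspec[OF F(1) m] by (simp flip: sum_distrib_right)
    from is_form_mult[OF is_form_const this, of "Poly_Mapping.lookup F m"]
    show "is_form (d * e) (\<lambda>x. Poly_Mapping.lookup F m *
        (\<Prod>i\<in>UNIV. ((\<chi> i. g i x) $ i) ^ Poly_Mapping.lookup m i))"
      by simp
  qed
qed

section \<open>Top coefficients relative to degree bounds, and restriction of forms to lines\<close>

lemma coeff_mult_add_of_degree_le:
  fixes p q :: "'a::comm_semiring_0 poly"
  assumes "degree p \<le> m" "degree q \<le> n"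
  shows "coeff (p * q) (m + n) = coeff p m * coeff q n"
proof (cases "degree p = m \<and> degree q = n")
  case True
  then show ?thesis using coeff_mult_degree_sum[of p q] by simp
next
  case False
  then have "degree p + degree q < m + n" "degree p < m \<or> degree q < n" using assms by auto
  moreover have "degree (p * q) \<le> degree p + degree q" by (rule degree_mult_le)
  ultimately show ?thesis by (auto simp: coeff_eq_0)
qed

text \<open>Because the \<open>d i\<close> are only upper bounds, the coefficient at the bound may
  vanish; it is multiplicative all the same, which allows factors of smaller degree.\<close>

lemma
  fixes f :: "'i \<Rightarrow> 'a::comm_semiring_1 poly"
  assumes "finite A" "\<And>i. i \<in> A \<Longrightarrow> degree (f i) \<le> d i"
  shows degree_prod_le: "degree (prod f A) \<le> sum d A"
    and coeff_prod_sum: "coeff (prod f A) (sum d A) = (\<Prod>i\<in>A. coeff (f i) (d i))"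
proof -
  have "degree (prod f A) \<le> sum d A \<and> coeff (prod f A) (sum d A) = (\<Prod>i\<in>A. coeff (f i) (d i))"
    using assms
  proof (induction A rule: finite_induct)
    case (insert a A)
    then have "degree (f a) \<le> d a" "degree (prod f A) \<le> sum d A"
      "coeff (prod f A) (sum d A) = (\<Prod>i\<in>A. coeff (f i) (d i))" by auto
    then show ?case using insert.hyps
      by (auto simp: coeff_mult_add_of_degree_le intro: order_trans[OF degree_mult_le])
  qed simp
  then show "degree (prod f A) \<le> sum d A"
    "coeff (prod f A) (sum d A) = (\<Prod>i\<in>A. coeff (f i) (d i))" by auto
qed

lemma
  fixes p :: "'a::comm_semiring_1 poly"
  assumes "degree p \<le> d"
  shows degree_power_le': "degree (p ^ k) \<le> k * d"
    and coeff_power_mult: "coeff (p ^ k) (k * d) = coeff p d ^ k"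
  using degree_prod_le[of "{..<k}" "\<lambda>_. p" "\<lambda>_. d"] coeff_prod_sum[of "{..<k}" "\<lambda>_. p" "\<lambda>_. d"] assms
  by auto

text \<open>The coefficient of \<open>t ^ d\<close> is the value at the point at infinity of the line.\<close>

lemma is_form_restrict_line:
  fixes f :: "'a::field ^ 'n::finite \<Rightarrow> 'a"
  assumes "is_form d f"
  obtains p where "degree p \<le> d" "\<And>t. poly p t = f (a + t *s b)" "coeff p d = f b"
proof -
  obtain F where F: "\<forall>m\<in>Poly_Mapping.keys F. (\<Sum>i\<in>UNIV. Poly_Mapping.lookup m i) = d"
    "f = (\<lambda>x. \<Sum>m\<in>Poly_Mapping.keys F.
        Poly_Mapping.lookup F m * (\<Prod>i\<in>UNIV. (x $ i) ^ Poly_Mapping.lookup m i))"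
    using assms unfolding is_form_iff by blast
  \<comment> \<open>On the line each coordinate is a linear polynomial in the parameter, so a
    monomial restricts to a product of powers of these. The slope \<open>b $ i\<close> may be
    zero.\<close>
  define M where "M m = (\<Prod>i\<in>UNIV. [:a $ i, b $ i:] ^ Poly_Mapping.lookup m i)" for m
  define p where "p = (\<Sum>m\<in>Poly_Mapping.keys F. smult (Poly_Mapping.lookup F m) (M m))"
  have lin: "degree ([:a $ i, b $ i:] ^ k) \<le> k" "coeff ([:a $ i, b $ i:] ^ k) k = (b $ i) ^ k" for i k
    using degree_power_le'[of "[:a $ i, b $ i:]" 1 k] coeff_power_mult[of "[:a $ i, b $ i:]" 1 k]
    by auto
  have "degree (M m) \<le> d"
    and coeff: "coeff (M m) d = (\<Prod>i\<in>UNIV. (b $ i) ^ Poly_Mapping.lookup m i)"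
    if "m \<in> Poly_Mapping.keys F" for m
    unfolding M_def using lin bspec[OF F(1) that]
      degree_prod_le[of UNIV "\<lambda>i. [:a $ i, b $ i:] ^ Poly_Mapping.lookup m i" "Poly_Mapping.lookup m"]
      coeff_prod_sum[of UNIV "\<lambda>i. [:a $ i, b $ i:] ^ Poly_Mapping.lookup m i" "Poly_Mapping.lookup m"]
    by auto
  then have "degree p \<le> d"
    unfolding p_def by (intro degree_sum_le) (auto intro: order_trans[OF degree_smult_le])
  moreover have "poly p t = f (a + t *s b)" for t
    by (simp add: p_def M_def F(2) poly_sum poly_prod algebra_simps)
  moreover have "coeff p d = f b"
    by (simp add: p_def F(2) coeff_sum coeff)
  ultimately show ?thesis by (rule that)
qed

section \<open>The degree of an endomorphism\<close>

lemma proj_point_eq_iff: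
  fixes x y :: "'a::field ^ 'n::finite"
  assumes "x \<noteq> 0" "y \<noteq> 0"
  shows "proj_point x = proj_point y \<longleftrightarrow> (\<exists>c. c \<noteq> 0 \<and> y = c *s x)"
proof -
  have "proj_rel x x" "proj_rel y y" using assms by (auto simp: proj_rel_def intro!: exI[of _ 1])
  then show ?thesis using Quotient3_rel[OF Quotient3_proj, of x y] assms
    by (auto simp: proj_rel_def)
qed

lemma ex_defines_map_iff:
  "(\<exists>F. defines_map d F \<phi>) \<longleftrightarrow>
    (\<exists>f. (\<forall>i. is_form d (f i)) \<and> (\<forall>x. x \<noteq> 0 \<longrightarrow> (\<chi> i. f i x) \<noteq> 0 \<and>
      \<phi> (proj_point x) = proj_point (\<chi> i. f i x)))"
  (is "?L \<longleftrightarrow> ?R")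
proof
  assume ?L
  then obtain F where "defines_map d F \<phi>" ..
  then show ?R
    by (intro exI[of _ "\<lambda>i x. mvpoly_eval x (F i)"])
       (auto simp: defines_map_def is_form_def vec_eq_iff)
next
  assume ?R
  then obtain f where f: "\<And>i. is_form d (f i)"
    "\<And>x. x \<noteq> 0 \<Longrightarrow> (\<chi> i. f i x) \<noteq> 0 \<and> \<phi> (proj_point x) = proj_point (\<chi> i. f i x)"
    by blast
  obtain F where "\<And>i. homogeneous d (F i)" "\<And>i x. mvpoly_eval x (F i) = f i x"
    using f(1) unfolding is_form_def by metis
  then show ?L using f(2)
    by (intro exI[of _ F]) (auto simp: defines_map_def vec_eq_iff)
qed

text \<open>The polynomial splits into linear factors, so its degree can be read off from its
  multiset of roots.\<close>

lemma size_proots_alg_closed: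
  fixes p :: "'a::alg_closed_field poly"
  assumes "p \<noteq> 0"
  shows "size (proots p) = degree p"
proof -
  obtain A where A: "size A = degree p" "p = smult (lead_coeff p) (\<Prod>x\<in>#A. [:-x, 1:])"
    using alg_closed_imp_factorization[OF assms] by blast
  have "proots (\<Prod>x\<in>#A. [:-x, 1:]) = A"
  proof (induction A)
    case (add x A)
    have "proots ([:-x, 1:] * (\<Prod>x\<in>#A. [:-x, 1:])) =
        proots [:-x, 1:] + proots (\<Prod>x\<in>#A. [:-x, 1:])"
      by (rule proots_mult) (auto simp: prod_mset_zero_iff)
    with add have "proots ([:-x, 1:] * (\<Prod>x\<in>#A. [:-x, 1:])) = {#x#} + A"
      by (simp del: mult_pCons_left)
    then show ?case by (simp del: mult_pCons_left)
  qed simp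
  then have "proots p = A"
    using assms by (subst A(2)) simp
  then show ?thesis using A(1) by simp
qed

text \<open>On a projective line two coprime systems of binary forms defining the same map agree up to
  a constant; it suffices to compare the roots of one coordinate that does not vanish at infinity.\<close>

lemma defines_map_degree_unique:
  fixes \<phi> :: "('a::{alg_closed_field, field_char_0}, 'n::finite) proj \<Rightarrow> ('a, 'n) proj"
  assumes card: "CARD('n) \<ge> 2" and "\<exists>F. defines_map d F \<phi>" "\<exists>G. defines_map e G \<phi>"
  shows "d = e"
proof -
  obtain f where f: "\<And>i. is_form d (f i)" "\<And>x. x \<noteq> 0 \<Longrightarrow> (\<chi> i. f i x) \<noteq> 0"
    "\<And>x. x \<noteq> 0 \<Longrightarrow> \<phi> (proj_point x) = proj_point (\<chi> i. f i x)"
    using assms(2) unfolding ex_defines_map_iff by blast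
  obtain g where g: "\<And>i. is_form e (g i)" "\<And>x. x \<noteq> 0 \<Longrightarrow> (\<chi> i. g i x) \<noteq> 0"
    "\<And>x. x \<noteq> 0 \<Longrightarrow> \<phi> (proj_point x) = proj_point (\<chi> i. g i x)"
    using assms(3) unfolding ex_defines_map_iff by blast
  \<comment> \<open>The factor \<open>c\<close> depends on the point \<open>x\<close>, so this is
    not yet a proportionality of forms.\<close>
  have ratio: "\<exists>c. c \<noteq> 0 \<and> (\<forall>i. g i x = c * f i x)" if "x \<noteq> 0" for x
  proof -
    have "proj_point (\<chi> i. f i x) = proj_point (\<chi> i. g i x)"
      using f(3)[OF that] g(3)[OF that] by simp
    then show ?thesis
      unfolding proj_point_eq_iff[OF f(2)[OF that] g(2)[OF that]] by (simp add: vec_eq_iff)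
  qed
  \<comment> \<open>Two coordinate vectors span a projective line, whose points are
    \<open>a + t *s b\<close> and the point at infinity \<open>b\<close>.\<close>
  obtain k l :: 'n where kl: "k \<noteq> l"
    using card by (metis card_2_iff' ex_card UNIV_I subset_UNIV)
  define a b :: "'a ^ 'n" where "a = axis k 1" and "b = axis l 1"
  have b0: "b \<noteq> 0" and line0: "a + t *s b \<noteq> 0" for t
  proof -
    show "b \<noteq> 0" by (simp add: b_def)
    have "(a + t *s b) $ k \<noteq> 0" using kl by (simp add: a_def b_def axis_def)
    then show "a + t *s b \<noteq> 0" by (metis zero_index)
  qed
  have "\<exists>p. degree p \<le> d \<and> (\<forall>t. poly p t = f i (a + t *s b)) \<and> coeff p d = f i b" for i
    using is_form_restrict_line[OF f(1)[of i], of a b] by metis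
  then obtain p where p: "\<And>i. degree (p i) \<le> d" "\<And>i t. poly (p i) t = f i (a + t *s b)"
    "\<And>i. coeff (p i) d = f i b" by metis
  have "\<exists>p. degree p \<le> e \<and> (\<forall>t. poly p t = g i (a + t *s b)) \<and> coeff p e = g i b" for i
    using is_form_restrict_line[OF g(1)[of i], of a b] by metis
  then obtain q where q: "\<And>i. degree (q i) \<le> e" "\<And>i t. poly (q i) t = g i (a + t *s b)"
    "\<And>i. coeff (q i) e = g i b" by metis
  \<comment> \<open>A coordinate not vanishing at infinity has restrictions of degree exactly
    \<open>d\<close> and \<open>e\<close>.\<close>
  obtain i where i: "f i b \<noteq> 0" using f(2)[OF b0] by (auto simp: vec_eq_iff)
  then have i': "g i b \<noteq> 0" using ratio[OF b0] by auto
  have deg: "degree (p i) = d" "degree (q i) = e"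
    using p(1,3)[of i] q(1,3)[of i] i i' by (auto intro!: antisym le_degree)
  have nz: "p i \<noteq> 0" "q i \<noteq> 0" using p(3)[of i] q(3)[of i] i i' by auto
  \<comment> \<open>Cross-multiplication removes the factor depending on \<open>t\<close>; over an
    infinite field equal values give equal polynomials.\<close>
  have cross: "p i * q j = p j * q i" for j
  proof -
    have "poly (p i * q j) = poly (p j * q i)"
    proof
      fix t
      obtain c where "\<And>i. g i (a + t *s b) = c * f i (a + t *s b)" using ratio[OF line0] by blast
      then show "poly (p i * q j) t = poly (p j * q i) t" by (simp add: p q)
    qed
    then show ?thesis by (simp only: poly_eq_poly_eq_iff)
  qed
  have "order t (p i) = order t (q i)" for t
  proof -
    \<comment> \<open>Without common zeros some \<open>p j\<close> is nonzero at \<open>t\<close>,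
      and then so is \<open>q j\<close>; both contribute order 0 to the cross relation.\<close>
    obtain j where j: "f j (a + t *s b) \<noteq> 0" using f(2)[OF line0[of t]] by (auto simp: vec_eq_iff)
    then have "g j (a + t *s b) \<noteq> 0" using ratio[OF line0[of t]] by auto
    then have nr: "poly (p j) t \<noteq> 0" "poly (q j) t \<noteq> 0" using j by (simp_all add: p q)
    then have nz': "p j \<noteq> 0" "q j \<noteq> 0" by auto
    have "order t (p i) + order t (q j) = order t (p j) + order t (q i)"
      using order_mult[of "p i" "q j" t] order_mult[of "p j" "q i" t] cross[of j] nz nz' by simp
    then show ?thesis using nr by (simp add: order_0I)
  qed
  then have "proots (p i) = proots (q i)" using nz by (intro multiset_eqI) simp
  then show ?thesis using size_proots_alg_closed[of "p i"] size_proots_alg_closed[of "q i"] nz deg by simp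
qed

section \<open>Identity, composition and multiplicativity of the degree\<close>

lemma defines_map_id: "\<exists>F. defines_map 1 F id"
  unfolding ex_defines_map_iff
  by (intro exI[of _ "\<lambda>i x :: _ ^ _. x $ i"]) (auto simp: is_form_coordinate vec_eq_iff simp del: One_nat_def)

lemma defines_map_comp:
  assumes "\<exists>F. defines_map d F \<phi>" "\<exists>G. defines_map e G \<psi>"
  shows "\<exists>F. defines_map (d * e) F (\<phi> \<circ> \<psi>)"
proof -
  obtain f where f: "\<And>i. is_form d (f i)" "\<And>x. x \<noteq> 0 \<Longrightarrow> (\<chi> i. f i x) \<noteq> 0 \<and>
    \<phi> (proj_point x) = proj_point (\<chi> i. f i x)"
    using assms(1) unfolding ex_defines_map_iff by blast
  obtain g where g: "\<And>i. is_form e (g i)" "\<And>x. x \<noteq> 0 \<Longrightarrow> (\<chi> i. g i x) \<noteq> 0 \<and>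
    \<psi> (proj_point x) = proj_point (\<chi> i. g i x)"
    using assms(2) unfolding ex_defines_map_iff by blast
  show ?thesis unfolding ex_defines_map_iff
    using f g by (intro exI[of _ "\<lambda>i x. f i (\<chi> j. g j x)"]) (auto intro: is_form_comp)
qed

context
  assumes card: "CARD('n::finite) \<ge> 2"
begin

text \<open>With a single coordinate every degree defines the only map; two coordinates give the
  uniqueness that the definite description requires.\<close>

lemma endo_degree_eqI:
  fixes \<phi> :: "('a::{alg_closed_field, field_char_0}, 'n) proj \<Rightarrow> ('a, 'n) proj"
  assumes "\<exists>F. defines_map d F \<phi>"
  shows "endo_degree \<phi> = d"
  unfolding endo_degree_def using assms defines_map_degree_unique[OF card]
  by (intro the_equality) blast+

lemma endomorphism_defines_map:
  fixes \<phi> :: "('a::{alg_closed_field, field_char_0}, 'n) proj \<Rightarrow> ('a, 'n) proj"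
  assumes "endomorphism \<phi>"
  shows "\<exists>F. defines_map (endo_degree \<phi>) F \<phi>"
  using assms endo_degree_eqI unfolding endomorphism_def by metis

lemma endomorphism_id: "endomorphism (id :: ('a::alg_closed_field, 'n) proj \<Rightarrow> _)"
  using defines_map_id unfolding endomorphism_def by blast

lemma endo_degree_id:
  "endo_degree (id :: ('a::{alg_closed_field, field_char_0}, 'n) proj \<Rightarrow> _) = 1"
  by (rule endo_degree_eqI) (rule defines_map_id)

lemma
  fixes \<phi> \<psi> :: "('a::{alg_closed_field, field_char_0}, 'n) proj \<Rightarrow> ('a, 'n) proj"
  assumes "endomorphism \<phi>" "endomorphism \<psi>"
  shows endomorphism_comp: "endomorphism (\<phi> \<circ> \<psi>)"
    and endo_degree_comp: "endo_degree (\<phi> \<circ> \<psi>) = endo_degree \<phi> * endo_degree \<psi>"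
proof -
  have *: "\<exists>F. defines_map (endo_degree \<phi> * endo_degree \<psi>) F (\<phi> \<circ> \<psi>)"
    by (intro defines_map_comp endomorphism_defines_map assms)
  show "endomorphism (\<phi> \<circ> \<psi>)" using * unfolding endomorphism_def by blast
  show "endo_degree (\<phi> \<circ> \<psi>) = endo_degree \<phi> * endo_degree \<psi>" by (rule endo_degree_eqI[OF *])
qed

end

section \<open>Counting functions of sequences with linear growth\<close>

text \<open>From \<open>N\<close> on, a value at most \<open>b\<close> forces the index to be at
  most \<open>b / m\<close>; counting all indices below \<open>N\<close> costs only a
  constant.\<close>

lemma finite_sublevel_linear_growth:
  fixes a :: "nat \<Rightarrow> real"
  assumes m: "m > 0" and N: "\<And>n. n \<ge> N \<Longrightarrow> m * real n \<le> a n" and b: "b \<ge> 0"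
  shows "finite {n. a n \<le> b}" and "real (card {n. a n \<le> b}) \<le> real N + b / m + 1"
proof -
  have sub: "{n. a n \<le> b} \<subseteq> {..<N} \<union> {..nat \<lfloor>b / m\<rfloor>}"
  proof
    fix n assume n: "n \<in> {n. a n \<le> b}"
    show "n \<in> {..<N} \<union> {..nat \<lfloor>b / m\<rfloor>}"
    proof (cases "n < N")
      case False
      then have "m * real n \<le> b" using N[of n] n by simp
      then have "real n \<le> b / m" using m by (simp add: field_simps)
      then have "n \<le> nat \<lfloor>b / m\<rfloor>" by (simp add: le_nat_floor)
      then show ?thesis by simp
    qed simp
  qed
  then show "finite {n. a n \<le> b}" by (rule finite_subset) auto
  have "card {n. a n \<le> b} \<le> card ({..<N} \<union> {..nat \<lfloor>b / m\<rfloor>})"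
    by (rule card_mono[OF _ sub]) auto
  also have "\<dots> \<le> N + (nat \<lfloor>b / m\<rfloor> + 1)"
    using card_Un_le[of "{..<N}" "{..nat \<lfloor>b / m\<rfloor>}"] by simp
  finally have "real (card {n. a n \<le> b}) \<le> real N + real (nat \<lfloor>b / m\<rfloor>) + 1" by linarith
  also have "real (nat \<lfloor>b / m\<rfloor>) \<le> b / m" using m b by simp
  finally show "real (card {n. a n \<le> b}) \<le> real N + b / m + 1" by simp
qed

lemma card_sublevel_linear_growth_ge:
  fixes a :: "nat \<Rightarrow> real"
  assumes m: "m > 0" and N: "\<And>n. n \<ge> N \<Longrightarrow> a n \<le> m * real n" and b: "b \<ge> 0"
    and fin: "finite {n. a n \<le> b}"
  shows "b / m - real N \<le> real (card {n. a n \<le> b})"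
proof -
  have "{N..nat \<lfloor>b / m\<rfloor>} \<subseteq> {n. a n \<le> b}"
  proof
    fix n assume n: "n \<in> {N..nat \<lfloor>b / m\<rfloor>}"
    then have "int n \<le> \<lfloor>b / m\<rfloor>" using m b by (simp add: le_nat_iff)
    then have "real n \<le> b / m" by linarith
    then have "m * real n \<le> b" using m by (simp add: field_simps)
    then show "n \<in> {n. a n \<le> b}" using N[of n] n by simp
  qed
  then have "card {N..nat \<lfloor>b / m\<rfloor>} \<le> card {n. a n \<le> b}"
    by (rule card_mono[OF fin])
  then have "real (nat \<lfloor>b / m\<rfloor>) + 1 - real N \<le> real (card {n. a n \<le> b})"
    by simp
  moreover have "b / m \<le> real (nat \<lfloor>b / m\<rfloor>) + 1"
    by linarith
  ultimately show ?thesis by linarith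
qed

text \<open>The sequence is compared with lines of slope slightly below and slightly above
  \<open>l\<close>; the additive constants disappear after division by \<open>b\<close>.\<close>

lemma tendsto_card_sublevel:
  fixes a :: "nat \<Rightarrow> real"
  assumes lim: "(\<lambda>n. a n / real n) \<longlonglongrightarrow> l" and l: "l > 0"
  shows "((\<lambda>b. real (card {n. a n \<le> b}) / b) \<longlongrightarrow> 1 / l) at_top"
proof (rule order_tendstoI)
  fix u assume u: "1 / l < u"
  then have u0: "u > 0" using l by (meson less_trans zero_less_divide_1_iff)
  then have "1 / u < l" using u l by (simp add: field_simps)
  then obtain m where m: "1 / u < m" "m < l" using dense by blast
  have m0: "m > 0" using m(1) u0 by (meson less_trans zero_less_divide_1_iff)
  obtain N where N: "\<And>n. n \<ge> N \<Longrightarrow> m < a n / real n"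
    using order_tendstoD(1)[OF lim m(2)] by (auto simp: eventually_sequentially)
  have N': "m * real n \<le> a n" if "n \<ge> Suc N" for n
    using N[of n] that by (simp add: field_simps)
  have "((\<lambda>b. (real (Suc N) + b / m + 1) / b) \<longlongrightarrow> 1 / m) at_top"
    using m0 by real_asymp (simp add: inverse_eq_divide)
  moreover have "1 / m < u" using m m0 u0 by (simp add: field_simps)
  ultimately have "eventually (\<lambda>b. (real (Suc N) + b / m + 1) / b < u) at_top"
    by (rule order_tendstoD(2))
  then show "eventually (\<lambda>b. real (card {n. a n \<le> b}) / b < u) at_top"
    using eventually_gt_at_top[of 0]
  proof eventually_elim
    case (elim b)
    have "real (card {n. a n \<le> b}) / b \<le> (real (Suc N) + b / m + 1) / b"
      using finite_sublevel_linear_growth(2)[of m "Suc N" a b] m0 N' elim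
      by (intro divide_right_mono) auto
    then show ?case using elim by simp
  qed
next
  fix u assume u: "u < 1 / l"
  \<comment> \<open>The maximum with 0 keeps \<open>v\<close> positive, so that \<open>1 / v\<close>
    is a positive slope.\<close>
  then have "max u 0 < 1 / l" using l by simp
  then obtain v where v: "max u 0 < v" "v < 1 / l" using dense by blast
  define m where "m = 1 / v"
  have m: "m > 0" "l < m" "1 / m = v"
    using v l by (auto simp: m_def field_simps)
  obtain N where N: "\<And>n. n \<ge> N \<Longrightarrow> a n / real n < m"
    using order_tendstoD(2)[OF lim m(2)] by (auto simp: eventually_sequentially)
  \<comment> \<open>\<open>Suc N\<close> excludes \<open>n = 0\<close>, where the quotient is 0 by
    convention and says nothing about \<open>a 0\<close>.\<close>
  have N': "a n \<le> m * real n" if "n \<ge> Suc N" for n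
    using N[of n] that by (simp add: field_simps)
  \<comment> \<open>A lower bound of slope \<open>l / 2\<close> gives finiteness:
    \<open>card\<close> of an infinite set is 0, which would spoil the lower estimate.\<close>
  obtain M where M: "\<And>n. n \<ge> M \<Longrightarrow> l / 2 < a n / real n"
    using order_tendstoD(1)[OF lim, of "l / 2"] l by (auto simp: eventually_sequentially)
  have M': "l / 2 * real n \<le> a n" if "n \<ge> Suc M" for n
    using M[of n] that by (simp add: field_simps)
  have "((\<lambda>b. (b / m - real (Suc N)) / b) \<longlongrightarrow> 1 / m) at_top"
    using m(1) by real_asymp (simp add: inverse_eq_divide)
  moreover have "u < 1 / m" using m v by simp
  ultimately have "eventually (\<lambda>b. u < (b / m - real (Suc N)) / b) at_top"
    by (rule order_tendstoD(1))
  then show "eventually (\<lambda>b. u < real (card {n. a n \<le> b}) / b) at_top"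
    using eventually_gt_at_top[of 0]
  proof eventually_elim
    case (elim b)
    have "finite {n. a n \<le> b}"
      using finite_sublevel_linear_growth(1)[of "l / 2" "Suc M" a b] l M' elim by auto
    then have "(b / m - real (Suc N)) / b \<le> real (card {n. a n \<le> b}) / b"
      using card_sublevel_linear_growth_ge[of m "Suc N" a b] m N' elim
      by (intro divide_right_mono) auto
    then show ?case using elim by simp
  qed
qed

section \<open>A strong law of large numbers\<close>

text \<open>For bounded \<open>f\<close>, Hoeffding's inequality makes deviation probabilities
  exponentially small in the number of terms, hence summable, and the Borel-Cantelli lemma
  applies.\<close>

lemma strong_law_PiM:
  fixes f :: "'a \<Rightarrow> real"
  assumes M: "prob_space M" and f: "f \<in> borel_measurable M"
    and bounds: "\<And>x. x \<in> space M \<Longrightarrow> f x \<in> {a..b}"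
  shows "AE \<gamma> in (\<Pi>\<^sub>M i\<in>(UNIV :: nat set). M).
    (\<lambda>n. (\<Sum>i<n. f (\<gamma> i)) / real n) \<longlonglongrightarrow> (\<integral>x. f x \<partial>M)"
proof -
  interpret M: prob_space M by fact
  interpret P: product_prob_space "\<lambda>_. M" "UNIV :: nat set" by unfold_locales
  note f [measurable]
  define PM where "PM = (\<Pi>\<^sub>M i\<in>(UNIV :: nat set). M)"
  interpret PM: prob_space PM unfolding PM_def by (rule P.P.prob_space_axioms)
  define \<mu> where "\<mu> = (\<integral>x. f x \<partial>M)"
  obtain x0 where "x0 \<in> space M" using M.not_empty by blast
  \<comment> \<open>Enlarging the interval to \<open>b + 1\<close> gives it positive length even if
    \<open>a = b\<close>.\<close>
  then have ab: "a < b + 1" using bounds[of x0] by simp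
  have comp: "distr PM M (\<lambda>\<gamma>. \<gamma> i) = M" for i
    unfolding PM_def by (rule distr_PiM_component) (auto simp: M)
  have [measurable]: "(\<lambda>\<gamma>. \<gamma> i) \<in> measurable PM M" for i
    unfolding PM_def by measurable
  \<comment> \<open>The joint law of the coordinates is \<open>PM\<close> itself, which is the
    product of their marginals.\<close>
  have "PM.indep_vars (\<lambda>_. M) (\<lambda>i \<gamma>. \<gamma> i) UNIV"
  proof (subst PM.indep_vars_iff_distr_eq_PiM)
    have "distr PM (Pi\<^sub>M UNIV (\<lambda>_. M)) (\<lambda>x. \<lambda>i\<in>UNIV. x i) = distr PM PM (\<lambda>x. x)"
      by (simp add: PM_def restrict_UNIV)
    then show "distr PM (Pi\<^sub>M UNIV (\<lambda>_. M)) (\<lambda>x. \<lambda>i\<in>UNIV. x i)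
        = (\<Pi>\<^sub>M i\<in>UNIV. distr PM M (\<lambda>\<gamma>. \<gamma> i))"
      by (simp add: comp[unfolded PM_def] PM_def)
  qed auto
  then have ind: "PM.indep_vars (\<lambda>_. borel) (\<lambda>i \<gamma>. f (\<gamma> i)) UNIV"
    by (rule PM.indep_vars_compose2) measurable
  have distr_f: "distr PM borel (\<lambda>\<gamma>. f (\<gamma> i)) = distr M borel f" for i
  proof -
    have "distr M borel f = distr (distr PM M (\<lambda>\<gamma>. \<gamma> i)) borel f" by (simp add: comp)
    also have "\<dots> = distr PM borel (\<lambda>\<gamma>. f (\<gamma> i))" by (subst distr_distr) (auto simp: comp_def)
    finally show ?thesis ..
  qed
  have exp_f: "PM.expectation (\<lambda>\<gamma>. f (\<gamma> i)) = \<mu>" for i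
  proof -
    have "\<mu> = (\<integral>x. f x \<partial>distr PM M (\<lambda>\<gamma>. \<gamma> i))" by (simp add: comp \<mu>_def)
    also have "\<dots> = PM.expectation (\<lambda>\<gamma>. f (\<gamma> i))" by (rule integral_distr) auto
    finally show ?thesis ..
  qed
  have bound: "PM.prob {\<gamma> \<in> space PM. \<bar>(\<Sum>i<n. f (\<gamma> i)) / real n - \<mu>\<bar> \<ge> \<epsilon>}
      \<le> 2 * exp (- 2 * real n * \<epsilon>\<^sup>2 / (b + 1 - a)\<^sup>2)" if "n > 0" "\<epsilon> \<ge> 0" for n \<epsilon>
  proof -
    interpret H: Hoeffding_ineq_iid PM "{..<n}" "\<lambda>i \<gamma>. f (\<gamma> i)" "\<lambda>\<gamma>. f (\<gamma> 0)" a "b + 1" \<mu>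
    proof unfold_locales
      show "PM.indep_vars (\<lambda>_. borel) (\<lambda>i \<gamma>. f (\<gamma> i)) {..<n}"
        by (rule PM.indep_vars_subset[OF ind]) simp
      show "AE \<gamma> in PM. f (\<gamma> 0) \<in> {a..b + 1}"
      proof (rule AE_I2)
        fix \<gamma> assume "\<gamma> \<in> space PM"
        then have "\<gamma> 0 \<in> space M" by (auto simp: PM_def space_PiM)
        then show "f (\<gamma> 0) \<in> {a..b + 1}" using bounds[of "\<gamma> 0"] by auto
      qed
    qed (auto simp: distr_f exp_f)
    have "{..<n} \<noteq> {}" using that by auto
    then show ?thesis using H.Hoeffding_ineq_abs_ge'[of \<epsilon>] that ab by simp
  qed
  have "AE \<gamma> in PM. eventually (\<lambda>n. \<bar>(\<Sum>i<n. f (\<gamma> i)) / real n - \<mu>\<bar> < \<epsilon>) sequentially"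
    if \<epsilon>: "\<epsilon> > 0" for \<epsilon>
  proof -
    define A where "A n = {\<gamma> \<in> space PM. \<bar>(\<Sum>i<n. f (\<gamma> i)) / real n - \<mu>\<bar> \<ge> \<epsilon>}" for n
    define r where "r = exp (- 2 * \<epsilon>\<^sup>2 / (b + 1 - a)\<^sup>2)"
    have r: "0 < r" "r < 1" using \<epsilon> ab by (auto simp: r_def)
    have "summable (\<lambda>n. PM.prob (A n))"
    proof (rule summable_comparison_test')
      show "summable (\<lambda>n. 2 * r ^ n)" using r by (intro summable_mult summable_geometric) auto
      show "norm (PM.prob (A n)) \<le> 2 * r ^ n" if "n \<ge> 1" for n
        using bound[of n \<epsilon>] that \<epsilon>
        by (simp add: A_def r_def mult_ac flip: exp_of_nat_mult)
    qed
    moreover have "A n \<in> sets PM" for n unfolding A_def by measurable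
    ultimately have "AE \<gamma> in PM. eventually (\<lambda>n. \<gamma> \<in> space PM - A n) sequentially"
      by (intro borel_cantelli_AE1) (auto simp: PM.emeasure_eq_measure)
    then show ?thesis
      by eventually_elim (auto simp: A_def not_le elim: eventually_mono)
  qed
  \<comment> \<open>The null set depends on the tolerance, so only countably many tolerances are
    used.\<close>
  then have "AE \<gamma> in PM. \<forall>k. eventually (\<lambda>n.
      \<bar>(\<Sum>i<n. f (\<gamma> i)) / real n - \<mu>\<bar> < inverse (real (Suc k))) sequentially"
    by (subst AE_all_countable) auto
  then have "AE \<gamma> in PM. (\<lambda>n. (\<Sum>i<n. f (\<gamma> i)) / real n) \<longlonglongrightarrow> \<mu>"
  proof eventually_elim
    case (elim \<gamma>)
    show ?case
    proof (rule tendstoI)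
      fix e :: real assume "e > 0"
      then obtain k where "inverse (real (Suc k)) < e" using reals_Archimedean by blast
      with elim[rule_format, of k]
      show "eventually (\<lambda>n. dist ((\<Sum>i<n. f (\<gamma> i)) / real n) \<mu> < e) sequentially"
        by (auto simp: dist_real_def elim: eventually_mono)
    qed
  qed
  then show ?thesis unfolding PM_def \<mu>_def .
qed

section \<open>Heights along orbits\<close>

text \<open>The shape \<open>B * (d - 1)\<close> of the error survives composition because (d - 1) +
  d (e - 1) = d e - 1.\<close>

lemma quasi_multiplicative_comp:
  fixes h :: "'p \<Rightarrow> real"
  assumes f: "\<And>P. \<bar>h (f P) - d * h P\<bar> \<le> B * (d - 1)"
    and g: "\<And>P. \<bar>h (g P) - e * h P\<bar> \<le> B * (e - 1)" and d: "d \<ge> 0"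
  shows "\<bar>h ((f \<circ> g) P) - d * e * h P\<bar> \<le> B * (d * e - 1)"
proof -
  have "h ((f \<circ> g) P) - d * e * h P = (h (f (g P)) - d * h (g P)) + d * (h (g P) - e * h P)"
    by (simp add: algebra_simps)
  also have "\<bar>\<dots>\<bar> \<le> \<bar>h (f (g P)) - d * h (g P)\<bar> + d * \<bar>h (g P) - e * h P\<bar>"
    using abs_triangle_ineq[of "h (f (g P)) - d * h (g P)" "d * (h (g P) - e * h P)"] d
    by (simp add: abs_mult)
  also have "\<dots> \<le> B * (d - 1) + d * (B * (e - 1))"
    using f[of "g P"] mult_left_mono[OF g[of P] d] by linarith
  also have "\<dots> = B * (d * e - 1)" by (simp add: algebra_simps)
  finally show ?thesis .
qed

text \<open>Heights increase strictly, so orbit points are counted by their indices, and height at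
  most \<open>T\<close> becomes a sublevel at \<open>ln T\<close> of a sequence with slope
  \<open>l\<close>. An arbitrary sequence \<open>x\<close> covers both kinds of orbits.\<close>

lemma tendsto_card_orbit_height_le:
  fixes h :: "'p \<Rightarrow> real" and x :: "nat \<Rightarrow> 'p" and D :: "nat \<Rightarrow> real"
  assumes h: "\<And>n. \<bar>h (x n) - D n * H\<bar> \<le> B * (D n - 1)"
    and D0: "D 0 \<ge> 1" and D_Suc: "\<And>n. D (Suc n) \<ge> 2 * D n"
    and B: "B \<ge> 0" and H: "H > 3 * B"
    and lim: "(\<lambda>n. ln (D n) / real n) \<longlonglongrightarrow> l" and l: "l > 0"
  shows "((\<lambda>T. real (card {Q \<in> range x. h Q \<le> T}) / ln T) \<longlongrightarrow> 1 / l) at_top"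
proof -
  have D1: "D n \<ge> 1" for n
  proof (induction n)
    case (Suc n)
    then show ?case using D_Suc[of n] by linarith
  qed (rule D0)
  have lower: "h (x n) \<ge> D n * (H - B) + B" and upper: "h (x n) \<le> D n * (H + B) - B" for n
    using h[of n] by (auto simp: abs_le_iff algebra_simps)
  have pos: "h (x n) > 0" for n
    using lower[of n] mult_pos_pos[of "D n" "H - B"] D1[of n] B H by linarith
  have mono: "strict_mono (\<lambda>n. h (x n))"
  proof (rule strict_monoI_Suc)
    fix n
    \<comment> \<open>The factor 3 enters here: \<open>H + B \<le> 2 * (H - B)\<close> amounts to
      \<open>3 * B \<le> H\<close>, so the doubling of \<open>D\<close> outweighs the
      errors.\<close>
    have "D n * (3 * B) \<le> D n * H" using D1[of n] H by (intro mult_left_mono) auto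
    then have "D n * (H + B) - B \<le> (2 * D n) * (H - B) - B" by (simp add: algebra_simps)
    also have "(2 * D n) * (H - B) \<le> D (Suc n) * (H - B)"
      using D_Suc[of n] B H by (intro mult_right_mono) auto
    finally have weak: "D n * (H + B) - B \<le> D (Suc n) * (H - B) - B" by simp
    show "h (x n) < h (x (Suc n))"
    \<comment> \<open>For positive \<open>B\<close> the terms \<open>- B\<close> and
      \<open>+ B\<close> in the two bounds leave a strict gap; for \<open>B = 0\<close> strictness
      comes from the growth of \<open>D\<close> and \<open>H > 0\<close>.\<close>
    proof (cases "B = 0")
      case True
      have "D n * H < D (Suc n) * H"
        using D_Suc[of n] D1[of n] H True by (intro mult_strict_right_mono) auto
      then show ?thesis using upper[of n] lower[of "Suc n"] True by simp
    next
      case False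
      then show ?thesis using upper[of n] lower[of "Suc n"] weak B by linarith
    qed
  qed
  then have inj: "inj x" by (metis injI strict_mono_eq)
  have card_eq: "card {Q \<in> range x. h Q \<le> T} = card {n. ln (h (x n)) \<le> ln T}" if "T > 0" for T
  proof -
    have "{Q \<in> range x. h Q \<le> T} = x ` {n. ln (h (x n)) \<le> ln T}"
      using that pos by auto
    then show ?thesis using inj by (simp add: card_image inj_on_subset)
  qed
  \<comment> \<open>\<open>ln (h (x n))\<close> and \<open>ln (D n)\<close> differ by a bounded
    amount, which division by \<open>n\<close> removes.\<close>
  have lnlim: "(\<lambda>n. ln (h (x n)) / real n) \<longlonglongrightarrow> l"
  proof (rule tendsto_sandwich)
    have const: "(\<lambda>n. c / real n) \<longlonglongrightarrow> 0" for c :: real by real_asymp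
    have "(\<lambda>n. ln (D n) / real n + c / real n) \<longlonglongrightarrow> l" for c
      using tendsto_add[OF lim const] by simp
    then have shift: "(\<lambda>n. (ln (D n) + c) / real n) \<longlonglongrightarrow> l" for c
      by (simp add: add_divide_distrib)
    show "(\<lambda>n. (ln (D n) + ln (H - B)) / real n) \<longlonglongrightarrow> l"
      and "(\<lambda>n. (ln (D n) + ln (H + B)) / real n) \<longlonglongrightarrow> l" by (rule shift)+
    have pos': "D n > 0" "H - B > 0" "H + B > 0" for n using D1[of n] B H by linarith+
    have "ln (D n) + ln (H - B) \<le> ln (h (x n))" for n
    proof -
      have "ln (D n * (H - B)) \<le> ln (h (x n))"
        using lower[of n] pos' pos B by (subst ln_le_cancel_iff) auto
      then show ?thesis using pos'(1)[of n] pos'(2,3) by (simp add: ln_mult)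
    qed
    then show "\<forall>\<^sub>F n in sequentially. (ln (D n) + ln (H - B)) / real n \<le> ln (h (x n)) / real n"
      by (intro always_eventually allI divide_right_mono) auto
    have "ln (h (x n)) \<le> ln (D n) + ln (H + B)" for n
    proof -
      have "ln (h (x n)) \<le> ln (D n * (H + B))"
        using upper[of n] pos' pos B by (subst ln_le_cancel_iff) (auto intro: order_trans)
      then show ?thesis using pos'(1)[of n] pos'(2,3) by (simp add: ln_mult)
    qed
    then show "\<forall>\<^sub>F n in sequentially. ln (h (x n)) / real n \<le> (ln (D n) + ln (H + B)) / real n"
      by (intro always_eventually allI divide_right_mono) auto
  qed
  have "((\<lambda>T. real (card {n. ln (h (x n)) \<le> ln T}) / ln T) \<longlongrightarrow> 1 / l) at_top"
    by (rule filterlim_compose[OF tendsto_card_sublevel[OF lnlim l] ln_at_top])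
  then show ?thesis
    by (rule Lim_transform_eventually)
       (use eventually_gt_at_top[of 0] in eventually_elim, simp add: card_eq)
qed

section \<open>Random orbits\<close>

lemma left_orbit_eq_range: "left_orbit \<gamma> P = range (\<lambda>n. left_iter \<gamma> n P)"
  by (auto simp: left_orbit_def)

lemma right_orbit_eq_range: "right_orbit \<gamma> P = range (\<lambda>n. right_iter \<gamma> n P)"
  by (auto simp: right_orbit_def)

text \<open>The two iterates multiply the same degrees in opposite order. Each induction also
  carries \<open>endomorphism\<close>, which multiplicativity requires of both factors.\<close>

lemma
  fixes \<gamma> :: "nat \<Rightarrow> ('a::{alg_closed_field, field_char_0}, 'n::finite) proj \<Rightarrow> ('a, 'n) proj"
  assumes card: "CARD('n) \<ge> 2" and endo: "\<And>i. endomorphism (\<gamma> i)"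
  shows endo_degree_left_iter: "endo_degree (left_iter \<gamma> n) = (\<Prod>i<n. endo_degree (\<gamma> i))"
    and endo_degree_right_iter: "endo_degree (right_iter \<gamma> n) = (\<Prod>i<n. endo_degree (\<gamma> i))"
proof -
  have "endomorphism (left_iter \<gamma> n) \<and> endo_degree (left_iter \<gamma> n) = (\<Prod>i<n. endo_degree (\<gamma> i))"
  proof (induction n)
    case 0
    show ?case unfolding left_iter.simps
      using endomorphism_id endo_degree_id[OF card] by (metis card lessThan_0 prod.empty)
  next
    case (Suc n)
    then have IH: "endomorphism (left_iter \<gamma> n)"
      "endo_degree (left_iter \<gamma> n) = (\<Prod>i<n. endo_degree (\<gamma> i))" by auto
    show ?case unfolding left_iter.simps
      using endomorphism_comp[OF card endo IH(1), of n] endo_degree_comp[OF card endo IH(1), of n] IH(2)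
      by (metis mult.commute prod.lessThan_Suc)
  qed
  then show "endo_degree (left_iter \<gamma> n) = (\<Prod>i<n. endo_degree (\<gamma> i))" ..
  have "endomorphism (right_iter \<gamma> n) \<and> endo_degree (right_iter \<gamma> n) = (\<Prod>i<n. endo_degree (\<gamma> i))"
  proof (induction n)
    case 0
    show ?case unfolding right_iter.simps
      using endomorphism_id endo_degree_id[OF card] by (metis card lessThan_0 prod.empty)
  next
    case (Suc n)
    then have IH: "endomorphism (right_iter \<gamma> n)"
      "endo_degree (right_iter \<gamma> n) = (\<Prod>i<n. endo_degree (\<gamma> i))" by auto
    show ?case unfolding right_iter.simps
      using endomorphism_comp[OF card IH(1) endo, of n] endo_degree_comp[OF card IH(1) endo, of n] IH(2)
      by (metis mult.commute prod.lessThan_Suc)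
  qed
  then show "endo_degree (right_iter \<gamma> n) = (\<Prod>i<n. endo_degree (\<gamma> i))" ..
qed

lemma
  fixes h :: "'p \<Rightarrow> real" and d :: "nat \<Rightarrow> real"
  assumes \<gamma>: "\<And>i P. \<bar>h (\<gamma> i P) - d i * h P\<bar> \<le> B * (d i - 1)" and d: "\<And>i. d i \<ge> 0"
  shows height_left_iter: "\<bar>h (left_iter \<gamma> n P) - (\<Prod>i<n. d i) * h P\<bar> \<le> B * ((\<Prod>i<n. d i) - 1)"
    and height_right_iter: "\<bar>h (right_iter \<gamma> n P) - (\<Prod>i<n. d i) * h P\<bar> \<le> B * ((\<Prod>i<n. d i) - 1)"
proof -
  show "\<bar>h (left_iter \<gamma> n P) - (\<Prod>i<n. d i) * h P\<bar> \<le> B * ((\<Prod>i<n. d i) - 1)"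
  proof (induction n arbitrary: P)
    case (Suc n)
    show ?case
      using quasi_multiplicative_comp[where h = h and f = "\<gamma> n" and g = "left_iter \<gamma> n", OF \<gamma> Suc d]
      by (simp add: mult.commute)
  qed simp
  show "\<bar>h (right_iter \<gamma> n P) - (\<Prod>i<n. d i) * h P\<bar> \<le> B * ((\<Prod>i<n. d i) - 1)"
  proof (induction n arbitrary: P)
    case (Suc n)
    \<comment> \<open>Here the long iterate is the outer map, so the whole product is the factor
      that must be nonnegative.\<close>
    have "(\<Prod>i<n. d i) \<ge> 0" using d by (simp add: prod_nonneg)
    then show ?case
      using quasi_multiplicative_comp[where h = h and f = "right_iter \<gamma> n" and g = "\<gamma> n", OF Suc \<gamma>]
      by simp
  qed simp
qed

text \<open>On a probability space two almost sure statements hold at a common point, where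
  uniqueness of limits identifies the two candidates.\<close>

lemma dynamical_degree_eqI:
  assumes "prob_space \<nu>" and "AE \<gamma> in seq_measure \<nu>.
     (\<lambda>n. root n (real (endo_degree (left_iter \<gamma> n)))) \<longlonglongrightarrow> \<delta> \<and>
     (\<lambda>n. root n (real (endo_degree (right_iter \<gamma> n)))) \<longlonglongrightarrow> \<delta>"
  shows "dynamical_degree \<nu> = \<delta>"
  unfolding dynamical_degree_def
proof (rule the_equality)
  interpret prob_space "seq_measure \<nu>"
    unfolding seq_measure_def using assms(1) by (intro prob_space_PiM)
  fix \<delta>'
  assume "AE \<gamma> in seq_measure \<nu>.
     (\<lambda>n. root n (real (endo_degree (left_iter \<gamma> n)))) \<longlonglongrightarrow> \<delta>' \<and>
     (\<lambda>n. root n (real (endo_degree (right_iter \<gamma> n)))) \<longlonglongrightarrow> \<delta>'"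
  with assms(2) have "AE \<gamma> in seq_measure \<nu>. \<delta>' = \<delta>"
    by eventually_elim (auto intro: LIMSEQ_unique)
  then show "\<delta>' = \<delta>" by simp
qed (rule assms(2))

text \<open>With \<open>B\<close> the real value of \<open>B_set S\<close>, the uniform error
  \<open>C_set S\<close> is \<open>B * (d_set S - 1)\<close>; as \<open>d_set S\<close> is at most
  each degree, this gives the bound that composition preserves.\<close>

lemma height_constants:
  fixes S :: "((qbar, 'n::finite) proj \<Rightarrow> (qbar, 'n) proj) set" and P :: "(qbar, 'n) proj"
  assumes ne: "S \<noteq> {}" and deg: "\<And>\<phi>. \<phi> \<in> S \<Longrightarrow> endo_degree \<phi> \<ge> 2"
    and P: "ereal (weil_height P) > 3 * B_set S"
  obtains B where "B \<ge> 0" "weil_height P > 3 * B"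
    "\<And>\<phi> Q. \<phi> \<in> S \<Longrightarrow>
      \<bar>weil_height (\<phi> Q) - real (endo_degree \<phi>) * weil_height Q\<bar> \<le> B * (real (endo_degree \<phi>) - 1)"
proof -
  define e where "e = real (d_set S) - 1"
  have d_le: "d_set S \<le> endo_degree \<phi>" if "\<phi> \<in> S" for \<phi>
    unfolding d_set_def using that by (intro cInf_lower) auto
  have d2: "d_set S \<ge> 2" unfolding d_set_def using ne deg by (intro cInf_greatest) auto
  then have e: "e > 0" by (simp add: e_def)
  have le_C: "ereal \<bar>weil_height (\<phi> Q) - real (endo_degree \<phi>) * weil_height Q\<bar> \<le> C_set S"
    if "\<phi> \<in> S" for \<phi> Q
    unfolding C_set_def C_map_def using that by (intro SUP_upper2[of \<phi>] SUP_upper) auto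
  obtain \<phi>0 where "\<phi>0 \<in> S" using ne by blast
  \<comment> \<open>Nonnegativity excludes the value minus infinity of the supremum.\<close>
  from order_trans[OF _ le_C[OF this, of P]] have C0: "C_set S \<ge> 0" by simp
  have "C_set S \<noteq> \<infinity>"
  proof
    assume "C_set S = \<infinity>"
    then have "B_set S = \<infinity>" using e by (simp add: B_set_def e_def)
    then show False using P by simp
  qed
  with C0 obtain C where C: "C_set S = ereal C" "C \<ge> 0" by (cases "C_set S") auto
  have B: "B_set S = ereal (C / e)" using d2 by (simp add: B_set_def C e_def)
  show ?thesis
  proof (rule that[of "C / e"])
    show "C / e \<ge> 0" using C e by simp
    show "weil_height P > 3 * (C / e)" using P B
      by (metis ereal_less_eq(3) not_le numeral_eq_ereal times_ereal.simps(1))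
    fix \<phi> Q assume \<phi>: "\<phi> \<in> S"
    have "\<bar>weil_height (\<phi> Q) - real (endo_degree \<phi>) * weil_height Q\<bar> \<le> C / e * e"
      using le_C[OF \<phi>, of Q] C e by simp
    also have "\<dots> \<le> C / e * (real (endo_degree \<phi>) - 1)"
      using d_le[OF \<phi>] C e by (intro mult_left_mono) (auto simp: e_def)
    finally show "\<bar>weil_height (\<phi> Q) - real (endo_degree \<phi>) * weil_height Q\<bar> \<le> \<dots>" .
  qed
qed

theorem corollary1p3:
  fixes N :: nat
    and S :: "((qbar, 'n::finite) proj \<Rightarrow> (qbar, 'n) proj) set"
    and \<nu> :: "((qbar, 'n) proj \<Rightarrow> (qbar, 'n) proj) measure"
  assumes "N \<ge> 1" and "CARD('n) = N + 1"
    and "finite S"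
    and "\<And>\<phi>. \<phi> \<in> S \<Longrightarrow> endomorphism \<phi> \<and> endo_degree \<phi> \<ge> 2"
    and "prob_space \<nu>" and "sets \<nu> = Pow S"
    and "\<And>\<phi>. \<phi> \<in> S \<Longrightarrow> measure \<nu> {\<phi>} > 0"
  shows "AE \<gamma> in seq_measure \<nu>. \<forall>P. ereal (weil_height P) > 3 * B_set S \<longrightarrow>
     ((\<lambda>B. real (card {Q \<in> left_orbit \<gamma> P. weil_height Q \<le> B}) / ln B)
        \<longlongrightarrow> 1 / ln (dynamical_degree \<nu>)) at_top \<and>
     ((\<lambda>B. real (card {W \<in> right_orbit \<gamma> P. weil_height W \<le> B}) / ln B)
        \<longlongrightarrow> 1 / ln (dynamical_degree \<nu>)) at_top"
proof -
  interpret \<nu>: prob_space \<nu> by fact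
  have card: "CARD('n) \<ge> 2" using assms(1,2) by simp
  have space: "space \<nu> = S" using sets_eq_imp_space_eq[of \<nu> "count_space S"] assms(6) by simp
  have ne: "S \<noteq> {}" using \<nu>.not_empty space by simp
  have endo: "endomorphism \<phi>" and deg: "endo_degree \<phi> \<ge> 2" if "\<phi> \<in> S" for \<phi>
    using assms(4)[OF that] by auto
  define f where "f \<phi> = ln (real (endo_degree \<phi>))" for \<phi> :: "(qbar, 'n) proj \<Rightarrow> (qbar, 'n) proj"
  define l where "l = (\<integral>\<phi>. f \<phi> \<partial>\<nu>)"
  define D where "D \<gamma> n = (\<Prod>i<n. real (endo_degree (\<gamma> i)))"
    for \<gamma> :: "nat \<Rightarrow> (qbar, 'n) proj \<Rightarrow> (qbar, 'n) proj" and n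
  have f_meas: "f \<in> borel_measurable \<nu>"
    by (rule measurableI) (auto simp: assms(6) space)
  have f_bounds: "f \<phi> \<in> {ln 2..Max (f ` S)}" if "\<phi> \<in> space \<nu>" for \<phi>
    using that deg[of \<phi>] assms(3) by (auto simp: space f_def)
  have f_int: "integrable \<nu> f"
  proof (rule \<nu>.integrable_const_bound[OF _ f_meas])
    have "norm (f \<phi>) \<le> Max (f ` S)" if "\<phi> \<in> space \<nu>" for \<phi>
    proof -
      have "(0::real) \<le> ln 2" by simp
      also have "\<dots> \<le> f \<phi>" using f_bounds[OF that] by simp
      finally show ?thesis using f_bounds[OF that] by simp
    qed
    then show "AE \<phi> in \<nu>. norm (f \<phi>) \<le> Max (f ` S)" by (rule AE_I2)
  qed
  \<comment> \<open>Degrees at least two make the growth rate positive, as the counting lemma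
    requires.\<close>
  have "(\<integral>\<phi>. ln 2 \<partial>\<nu>) \<le> l"
    unfolding l_def using f_int f_bounds by (intro integral_mono) auto
  then have "ln 2 \<le> l" by (simp add: \<nu>.prob_space)
  then have l: "l > 0" by (meson less_le_trans ln_gt_zero one_less_numeral_iff semiring_norm(76))
  have in_S: "AE \<gamma> in seq_measure \<nu>. \<forall>i. \<gamma> i \<in> S"
    by (rule AE_I2) (auto simp: seq_measure_def space_PiM space)
  have D_pos: "D \<gamma> n > 0" if "\<forall>i. \<gamma> i \<in> S" for \<gamma> n
    unfolding D_def using deg that by (intro prod_pos) (metis gr0I not_numeral_le_zero of_nat_0_less_iff)
  have "AE \<gamma> in seq_measure \<nu>. (\<lambda>n. (\<Sum>i<n. f (\<gamma> i)) / real n) \<longlonglongrightarrow> l"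
    unfolding seq_measure_def l_def using f_bounds
    by (intro strong_law_PiM[OF assms(5) f_meas]) auto
  \<comment> \<open>This event involves degrees only, so its null set is fixed before any point
    \<open>P\<close> is chosen.\<close>
  with in_S have good: "AE \<gamma> in seq_measure \<nu>. (\<forall>i. \<gamma> i \<in> S) \<and> (\<lambda>n. ln (D \<gamma> n) / real n) \<longlonglongrightarrow> l"
  proof eventually_elim
    case (elim \<gamma>)
    have "endo_degree (\<gamma> i) > 0" for i using deg[of "\<gamma> i"] elim(1) by force
    then have "ln (D \<gamma> n) = (\<Sum>i<n. f (\<gamma> i))" for n
      unfolding D_def f_def by (subst ln_prod) auto
    then show ?case using elim by simp
  qed
  have root: "(\<lambda>n. root n (D \<gamma> n)) \<longlonglongrightarrow> exp l"
    if "\<forall>i. \<gamma> i \<in> S" "(\<lambda>n. ln (D \<gamma> n) / real n) \<longlonglongrightarrow> l" for \<gamma>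
  proof (rule Lim_transform_eventually[OF tendsto_exp[OF that(2)]])
    show "eventually (\<lambda>n. exp (ln (D \<gamma> n) / real n) = root n (D \<gamma> n)) sequentially"
      \<comment> \<open>The identity fails at \<open>n = 0\<close>, where \<open>root 0\<close> is 0
        by convention.\<close>
      using eventually_gt_at_top[of 0]
    proof eventually_elim
      case (elim n)
      have "D \<gamma> n > 0" by (rule D_pos[OF that(1)])
      then show ?case using elim by (simp add: root_powr_inverse powr_def)
    qed
  qed
  have iter: "real (endo_degree (left_iter \<gamma> n)) = D \<gamma> n" "real (endo_degree (right_iter \<gamma> n)) = D \<gamma> n"
    if "\<forall>i. \<gamma> i \<in> S" for \<gamma> n
    using endo_degree_left_iter[OF card, of \<gamma> n] endo_degree_right_iter[OF card, of \<gamma> n] endo that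
    by (simp_all add: D_def)
  have "AE \<gamma> in seq_measure \<nu>.
     (\<lambda>n. root n (real (endo_degree (left_iter \<gamma> n)))) \<longlonglongrightarrow> exp l \<and>
     (\<lambda>n. root n (real (endo_degree (right_iter \<gamma> n)))) \<longlonglongrightarrow> exp l"
    using good
  proof eventually_elim
    case (elim \<gamma>)
    then show ?case using root[of \<gamma>] by (simp add: iter)
  qed
  then have dyn: "dynamical_degree \<nu> = exp l" by (rule dynamical_degree_eqI[OF assms(5)])
  show ?thesis
    using good
  proof eventually_elim
    case (elim \<gamma>)
    then have \<gamma>: "\<And>i. \<gamma> i \<in> S" and lim: "(\<lambda>n. ln (D \<gamma> n) / real n) \<longlonglongrightarrow> l" by auto
    show ?case
    proof (intro allI impI)
      fix P :: "(qbar, 'n) proj"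
      assume "ereal (weil_height P) > 3 * B_set S"
      then obtain B where B: "B \<ge> 0" "weil_height P > 3 * B"
        "\<And>\<phi> Q. \<phi> \<in> S \<Longrightarrow> \<bar>weil_height (\<phi> Q) - real (endo_degree \<phi>) * weil_height Q\<bar>
          \<le> B * (real (endo_degree \<phi>) - 1)"
        using height_constants[OF ne deg] by metis
      have D_Suc: "D \<gamma> (Suc n) \<ge> 2 * D \<gamma> n" for n
        using D_pos[of \<gamma> n] deg[OF \<gamma>[of n]] \<gamma> by (simp add: D_def mult.commute)
      \<comment> \<open>Only the height estimate and \<open>D \<gamma> 0 \<ge> 1\<close> remain
        open; \<open>left\<close> and \<open>right\<close> supply the estimate for the two
        orbits.\<close>
      note count = tendsto_card_orbit_height_le[where D = "D \<gamma>" and H = "weil_height P",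
          OF _ _ D_Suc B(1,2) lim l]
      have left: "\<bar>weil_height (left_iter \<gamma> n P) - D \<gamma> n * weil_height P\<bar> \<le> B * (D \<gamma> n - 1)"
        and right: "\<bar>weil_height (right_iter \<gamma> n P) - D \<gamma> n * weil_height P\<bar> \<le> B * (D \<gamma> n - 1)" for n
        unfolding D_def by (intro height_left_iter height_right_iter B(3) \<gamma>; simp)+
      show "((\<lambda>B. real (card {Q \<in> left_orbit \<gamma> P. weil_height Q \<le> B}) / ln B)
          \<longlongrightarrow> 1 / ln (dynamical_degree \<nu>)) at_top \<and>
        ((\<lambda>B. real (card {W \<in> right_orbit \<gamma> P. weil_height W \<le> B}) / ln B)
          \<longlongrightarrow> 1 / ln (dynamical_degree \<nu>)) at_top"
        unfolding left_orbit_eq_range right_orbit_eq_range dyn ln_exp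
        by (intro conjI count left right) (simp_all add: D_def)
    qed
  qed
qed

end
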